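(* Let $K$ be a positive integer, let $p_A,p_B\in[0,1]$ with neither $p_A=p_B=0$ nor $p_A=p_B=1$, and let $q_A=1-p_A$, $q_B=1-p_B$. If player $A$ serves first in the $K$-point set tie-breaker, the probability $\theta_{ST}(p_A,p_B,K)$ that $A$ wins the set tie-breaker is $$\theta_{ST}(p_A,p_B,K)=\sum_{h=0}^{K-2}\theta_{ST}(K,h;p_A,p_B,K)+\theta_{ST}(K-1,K-1;p_A,p_B,K)\,[\theta_{STT}(p_A,p_B)]^{I_A(2K-1)}[1-\theta_{STT}(p_B,p_A)]^{1-I_A(2K-1)},$$ where $\theta_{ST}(K,h;p_A,p_B,K)$, the probability that $A$ wins on a $(K,h)$ score ($0\le h\le K-2$), equals $$\left\{\sum_{j=0}^{K-1}\binom{s_A(K+h-1)}{j}\binom{s_B(K+h-1)}{(K-1)-j}\left[p_A^j q_A^{s_A(K+h-1)-j}\right]\left[q_B^{(K-1)-j}p_B^{s_B(K+h-1)-((K-1)-j)}\right]\right\}\left[p_A^{I_A(K+h)}q_B^{1-I_A(K+h)}\right],$$ and $\theta_{ST}(K-1,K-1;p_A,p_B,K)$, the probability that the score reaches $(K-1,K-1)$, equals $$\sum_{j=0}^{K-1}\binom{K-1}{j}\binom{K-1}{j}\left[p_A^jq_A^{(K-1)-j}\right]\left[q_B^{(K-1)-j}p_B^{j}\right].$$ Alternatively, with $B(K-1,p_A)$ and $B(K-1,q_B)$ independent binomial random variables, $$\sum_{h=0}^{K-2}\theta_{ST}(K,h;p_A,p_B,K)=\Pr\{B(K-1,p_A)+B(K-1,q_B)\ge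 K\}.$$ In addition, $\theta_{ST}(p_A,p_B,K)=\theta_{ST}(q_B,q_A,K)$.
   Context: Players $A$ and $B$ play points; all point outcomes are independent. When $A$ serves a point, $A$ wins it with probability $p_A$ (and $B$ wins it otherwise); when $B$ serves a point, $B$ wins it with probability $p_B$ (and $A$ wins it otherwise). $K$-point set tie-breaker (ST): the serving sequence is $ABBAABBAA\ldots$ when $A$ serves first. The first player to reach at least $K$ points with an advantage of at least two points wins. If the score becomes $(K-1,K-1)$, the set tie-breaker's tie-breaker (STT) ensues: the same serving sequence is continued, and the first player to be ahead by two points wins the STT and hence the ST. A score $(a,b)$ means $A$ has $a$ points and $B$ has $b$ points. $I_A(n)=I\{(n \bmod 4)\in\{0,1\}\}$ indicates that $A$ serves the $n$th point of the ST; $s_A(n)=\sum_{j=1}^n I\{(j\bmod 4)\in\{0,1\}\}$ and $s_B(n)=n-s_A(n)$ are the numbers of the first $n$ points served by $A$ and $B$. $\theta_{ST}(x,y,K)$ is the probability that the first server wins the ST when the first server wins each own-serve point with probability $x$ and the other player wins each own-serve point with probability $y$. $\theta_{STT}(x,y)$ is the probability that the first server of an STT (serving pattern $XYYXXYYX\ldots$ with $X$ the first server and $Y$ the other player, won by the first player ahead by two points) wins it, when the first server wins own-serve points with probability $x$ and the other player wins own-serve points with probability $y$. $B(m,r)$ denotes a binomial random variable with $m$ trials and success probability $r$. Conventions: $0^0=1$; $\binom{m}{k}=0$ if $k>m$, and any summand containing a zero binomial coefficient is $0$; empty sums are $0$. *)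

theory Defs
  imports "HOL-Probability.Probability"
begin

text \<open>
  Points are numbered from 1. An outcome \<open>\<omega>\<close> records, for every \<open>n \<ge> 1\<close>, whether the first server
  (player \<open>A\<close>) wins the \<open>n\<close>th point.
\<close>

definition I_A :: "nat \<Rightarrow> nat" where
  "I_A n = (if n mod 4 \<in> {0, 1} then 1 else 0)"

definition s_A :: "nat \<Rightarrow> nat" where
  "s_A n = (\<Sum>j = 1..n. I_A j)"

definition s_B :: "nat \<Rightarrow> nat" where
  "s_B n = n - s_A n"

definition first_server_point_prob :: "real \<Rightarrow> real \<Rightarrow> nat \<Rightarrow> real" where
  "first_server_point_prob x y n = (if I_A n = 1 then x else 1 - y)"

text \<open>
  The product measure makes all point outcomes independent. Points are generated forever; those after
  the end of the game do not affect any event below. The arguments are meant to lie in \<open>[0, 1]\<close>.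
\<close>

definition points :: "real \<Rightarrow> real \<Rightarrow> (nat \<Rightarrow> bool) measure" where
  "points x y = (\<Pi>\<^sub>M n\<in>{1..}. measure_pmf (bernoulli_pmf (first_server_point_prob x y n)))"

definition score_A :: "(nat \<Rightarrow> bool) \<Rightarrow> nat \<Rightarrow> nat" where
  "score_A \<omega> n = card {j \<in> {1..n}. \<omega> j}"

definition score_B :: "(nat \<Rightarrow> bool) \<Rightarrow> nat \<Rightarrow> nat" where
  "score_B \<omega> n = card {j \<in> {1..n}. \<not> \<omega> j}"

text \<open>
  A rule \<open>W a b\<close> says that a player with \<open>a\<close> points against \<open>b\<close> points satisfies the winning
  condition; the winner is the first player to satisfy it.
\<close>

definition in_play :: "(nat \<Rightarrow> nat \<Rightarrow> bool) \<Rightarrow> (nat \<Rightarrow> bool) \<Rightarrow> nat \<Rightarrow> bool" where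
  "in_play W \<omega> n \<longleftrightarrow>
     (\<forall>m<n. \<not> W (score_A \<omega> m) (score_B \<omega> m) \<and> \<not> W (score_B \<omega> m) (score_A \<omega> m))"

definition A_wins_at :: "(nat \<Rightarrow> nat \<Rightarrow> bool) \<Rightarrow> (nat \<Rightarrow> bool) \<Rightarrow> nat \<Rightarrow> bool" where
  "A_wins_at W \<omega> n \<longleftrightarrow> in_play W \<omega> n \<and> W (score_A \<omega> n) (score_B \<omega> n)"

text \<open>
  From score \<open>(K-1, K-1)\<close> on, the rule \<open>ST_rule K\<close> asks precisely for a two-point lead, so it
  includes the ensuing tie-breaker's tie-breaker.
\<close>

definition ST_rule :: "nat \<Rightarrow> nat \<Rightarrow> nat \<Rightarrow> bool" where
  "ST_rule K a b \<longleftrightarrow> K \<le> a \<and> b + 2 \<le> a"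

definition STT_rule :: "nat \<Rightarrow> nat \<Rightarrow> bool" where
  "STT_rule a b \<longleftrightarrow> b + 2 \<le> a"

definition \<theta>_ST :: "real \<Rightarrow> real \<Rightarrow> nat \<Rightarrow> real" where
  "\<theta>_ST x y K = \<P>(\<omega> in points x y. \<exists>n. A_wins_at (ST_rule K) \<omega> n)"

definition \<theta>_STT :: "real \<Rightarrow> real \<Rightarrow> real" where
  "\<theta>_STT x y = \<P>(\<omega> in points x y. \<exists>n. A_wins_at STT_rule \<omega> n)"

text \<open>
  \<open>\<theta>_ST_win a b x y K\<close>: the first server wins with final score \<open>(a, b)\<close>.
  \<open>\<theta>_ST_reach a b x y K\<close>: the score becomes \<open>(a, b)\<close> in the course of the game.
\<close>

definition \<theta>_ST_win :: "nat \<Rightarrow> nat \<Rightarrow> real \<Rightarrow> real \<Rightarrow> nat \<Rightarrow> real" where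
  "\<theta>_ST_win a b x y K =
     \<P>(\<omega> in points x y. \<exists>n. A_wins_at (ST_rule K) \<omega> n \<and> score_A \<omega> n = a \<and> score_B \<omega> n = b)"

definition \<theta>_ST_reach :: "nat \<Rightarrow> nat \<Rightarrow> real \<Rightarrow> real \<Rightarrow> nat \<Rightarrow> real" where
  "\<theta>_ST_reach a b x y K =
     \<P>(\<omega> in points x y. \<exists>n. in_play (ST_rule K) \<omega> n \<and> score_A \<omega> n = a \<and> score_B \<omega> n = b)"

end

theory Submission
  imports Defs
begin

text \<open>
  Look at the score after \<open>2 * (K - 1)\<close> points: a player who has \<open>K\<close> points by then leads by at least
  two, so the game is over unless the score is level. Either \<open>A\<close> has at least \<open>K\<close> of these points: then \<open>B\<close> has at most
  \<open>K - 2\<close>, and \<open>A\<close> won on reaching \<open>K\<close>, with final score \<open>(K, h)\<close> for some \<open>h \<le> K - 2\<close>. Or \<open>A\<close> has at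
  most \<open>K - 2\<close> points, and \<open>B\<close> has won. Or the score is \<open>(K - 1, K - 1)\<close>, and from then on a two-point
  lead decides. This trichotomy is \<open>A_wins_ST_iff\<close>.

  Each pair of points \<open>2 i + 1\<close>, \<open>2 i + 2\<close> contains exactly one serve of each player. So \<open>A\<close> serves
  \<open>K - 1\<close> of the first \<open>2 * (K - 1)\<close> points, and the number of points that \<open>A\<close> wins among them is a sum
  of two independent binomial variables (\<open>prob_score_A\<close>). Moreover, from a level score after an even
  number of points, from \<open>(K - 1, K - 1)\<close> on, the game stays undecided exactly as long as the following pairs are split, and
  the first pair that is not split decides it. Let \<open>x\<close> and \<open>y\<close> be the
  probabilities with which \<open>A\<close> and \<open>B\<close> win a point on their own serve. A pair is won twice by \<open>A\<close> with probability
  \<open>x * (1 - y)\<close> and twice by \<open>B\<close> with probability \<open>y * (1 - x)\<close>, whoever serves first in it. By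
  independence, \<open>A\<close> wins from the level score with probability
  \<open>x * (1 - y) / (x * (1 - y) + y * (1 - x))\<close>, the sum of a geometric series
  (\<open>prob_level_then_ahead\<close>); the excluded parameters are those for which every pair is split.

  The case \<open>K = 1\<close> shows that this fraction is \<open>\<theta>_STT x y\<close>. It equals \<open>1 - \<theta>_STT y x\<close>, so the two
  forms of the tie-breaker factor in the theorem agree. Replacing \<open>(x, y)\<close> by \<open>(1 - y, 1 - x)\<close> leaves
  the fraction unchanged and only exchanges the two binomial variables, which gives the symmetry.
\<close>

section \<open>Events that are decided after finitely many points\<close>

definition decided_after :: "nat \<Rightarrow> ((nat \<Rightarrow> bool) \<Rightarrow> bool) \<Rightarrow> bool" where
  "decided_after n Q \<longleftrightarrow> (\<forall>\<omega> \<omega>'. (\<forall>i\<in>{1..n}. \<omega> i = \<omega>' i) \<longrightarrow> Q \<omega> = Q \<omega>')"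

lemma decided_after_mono: "decided_after m Q \<Longrightarrow> m \<le> n \<Longrightarrow> decided_after n Q"
  unfolding decided_after_def by simp

lemma decided_after_conj:
  "decided_after n P \<Longrightarrow> decided_after n Q \<Longrightarrow> decided_after n (\<lambda>\<omega>. P \<omega> \<and> Q \<omega>)"
  unfolding decided_after_def by blast

lemma decided_after_Ball:
  "(\<And>i. i \<in> I \<Longrightarrow> decided_after n (Q i)) \<Longrightarrow> decided_after n (\<lambda>\<omega>. \<forall>i\<in>I. Q i \<omega>)"
  unfolding decided_after_def by blast

lemma decided_after_point: "1 \<le> i \<Longrightarrow> i \<le> n \<Longrightarrow> decided_after n (\<lambda>\<omega>. R (\<omega> i))"
  by (auto simp: decided_after_def)

lemma decided_after_score_A:
  assumes "m \<le> n"
  shows "decided_after n (\<lambda>\<omega>. R (score_A \<omega> m))"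
proof -
  have "score_A \<omega> m = score_A \<omega>' m" if "\<forall>i\<in>{1..n}. \<omega> i = \<omega>' i" for \<omega> \<omega>' :: "nat \<Rightarrow> bool"
    unfolding score_A_def using that assms by (intro arg_cong[where f=card]) auto
  then show ?thesis unfolding decided_after_def by metis
qed

lemma prob_space_points: "prob_space (points x y)"
  unfolding points_def by (intro prob_space_PiM measure_pmf.prob_space_axioms)

lemma sets_PiM_pmf_finite:
  fixes p :: "'i \<Rightarrow> 'b::countable pmf"
  assumes "finite J"
  shows "sets (\<Pi>\<^sub>M i\<in>J. measure_pmf (p i)) = Pow (\<Pi>\<^sub>E i\<in>J. UNIV)"
proof -
  have "sets (\<Pi>\<^sub>M i\<in>J. measure_pmf (p i)) = sets (\<Pi>\<^sub>M i\<in>J. count_space (UNIV::'b set))"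
    by (intro sets_PiM_cong) auto
  also have "\<dots> = Pow (\<Pi>\<^sub>E i\<in>J. UNIV)"
    using assms by (simp add: count_space_PiM_finite)
  finally show ?thesis .
qed

lemma decided_after_restrict:
  assumes "decided_after n Q"
  shows "Q (restrict \<omega> {1..n}) = Q \<omega>"
  using assms by (auto simp: decided_after_def)

text \<open>
  Such an event is the preimage, under restriction to finitely many coordinates, of a set of finite
  Boolean sequences, and all such sets are measurable.
\<close>

lemma decided_after_sets:
  assumes "decided_after n Q"
  shows "{\<omega> \<in> space (points x y). Q \<omega>} \<in> sets (points x y)"
proof -
  let ?B = "\<lambda>n. measure_pmf (bernoulli_pmf (first_server_point_prob x y n))"
  let ?V = "{v \<in> (\<Pi>\<^sub>E i\<in>{1..n}. UNIV). Q v}"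
  have "(\<lambda>\<omega>. restrict \<omega> {1..n}) \<in> measurable (points x y) (PiM {1..n} ?B)"
    unfolding points_def by (rule measurable_restrict_subset) auto
  moreover have "?V \<in> sets (PiM {1..n} ?B)"
    by (subst sets_PiM_pmf_finite) auto
  ultimately have "(\<lambda>\<omega>. restrict \<omega> {1..n}) -` ?V \<inter> space (points x y) \<in> sets (points x y)"
    by (rule measurable_sets)
  also have "(\<lambda>\<omega>. restrict \<omega> {1..n}) -` ?V \<inter> space (points x y) = {\<omega> \<in> space (points x y). Q \<omega>}"
    using decided_after_restrict[OF assms] by auto
  finally show ?thesis .
qed

lemma prob_point:
  assumes "1 \<le> i"
  shows "\<P>(\<omega> in points x y. R (\<omega> i)) =
    measure_pmf.prob (bernoulli_pmf (first_server_point_prob x y i)) {b. R b}"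
proof -
  let ?B = "\<lambda>n. measure_pmf (bernoulli_pmf (first_server_point_prob x y n))"
  interpret product_prob_space ?B "{1..}" by unfold_locales
  have "measure (distr (PiM {1..} ?B) (?B i) (\<lambda>\<omega>. \<omega> i)) {b. R b} = measure (?B i) {b. R b}"
    using assms by (subst PiM_component) auto
  moreover have "(\<lambda>\<omega>. \<omega> i) -` {b. R b} \<inter> space (PiM {1..} ?B) = {\<omega> \<in> space (PiM {1..} ?B). R (\<omega> i)}"
    by auto
  ultimately show ?thesis
    using assms unfolding points_def by (subst (asm) measure_distr) (auto intro!: measurable_component_singleton)
qed

lemma indep_vars_points:
  "prob_space.indep_vars (points x y)
     (\<lambda>n. measure_pmf (bernoulli_pmf (first_server_point_prob x y n))) (\<lambda>n \<omega>. \<omega> n) {1..}"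
proof -
  let ?B = "\<lambda>n. measure_pmf (bernoulli_pmf (first_server_point_prob x y n))"
  interpret product_prob_space ?B "{1..}" by unfold_locales
  interpret pts: prob_space "points x y" by (rule prob_space_points)
  have "distr (points x y) (PiM {1..} ?B) (\<lambda>\<omega>. \<lambda>i\<in>{1..}. \<omega> i) = distr (points x y) (points x y) (\<lambda>\<omega>. \<omega>)"
    by (intro distr_cong) (auto simp: points_def space_PiM)
  also have "\<dots> = PiM {1..} ?B"
    by (simp add: points_def)
  also have "\<dots> = PiM {1..} (\<lambda>i. distr (points x y) (?B i) (\<lambda>\<omega>. \<omega> i))"
    unfolding points_def by (intro PiM_cong refl PiM_component[symmetric])
  finally show ?thesis
    by (subst pts.indep_vars_iff_distr_eq_PiM') (auto simp: points_def intro!: measurable_component_singleton)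
qed

text \<open>
  This is the form in which independence is used throughout: disjoint blocks of coordinates of a
  product measure are independent, here the first \<open>n\<close> points and the next one.
\<close>

lemma prob_next_point:
  assumes "decided_after n Q"
  shows "\<P>(\<omega> in points x y. Q \<omega> \<and> R (\<omega> (Suc n))) =
    \<P>(\<omega> in points x y. Q \<omega>) * \<P>(\<omega> in points x y. R (\<omega> (Suc n)))"
proof -
  let ?M = "points x y"
  let ?B = "\<lambda>n. measure_pmf (bernoulli_pmf (first_server_point_prob x y n))"
  let ?V = "{v \<in> (\<Pi>\<^sub>E i\<in>{1..n}. UNIV). Q v}" and ?W = "{v \<in> (\<Pi>\<^sub>E i\<in>{Suc n}. UNIV). R (v (Suc n))}"
  interpret P: prob_space ?M by (rule prob_space_points)
  have "P.indep_var (PiM {1..n} ?B) (\<lambda>\<omega>. restrict (\<lambda>i. \<omega> i) {1..n})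
      (PiM {Suc n} ?B) (\<lambda>\<omega>. restrict (\<lambda>i. \<omega> i) {Suc n})"
    by (rule P.indep_var_restrict[OF indep_vars_points]) auto
  moreover have "?V \<in> sets (PiM {1..n} ?B)" "?W \<in> sets (PiM {Suc n} ?B)"
    by (subst sets_PiM_pmf_finite; auto)+
  ultimately have "P.prob ((\<lambda>\<omega>. (restrict \<omega> {1..n}, restrict \<omega> {Suc n})) -` (?V \<times> ?W) \<inter> space ?M) =
      P.prob ((\<lambda>\<omega>. restrict \<omega> {1..n}) -` ?V \<inter> space ?M) * P.prob ((\<lambda>\<omega>. restrict \<omega> {Suc n}) -` ?W \<inter> space ?M)"
    by (rule P.indep_varD)
  moreover have "(\<lambda>\<omega>. (restrict \<omega> {1..n}, restrict \<omega> {Suc n})) -` (?V \<times> ?W) \<inter> space ?M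
      = {\<omega> \<in> space ?M. Q \<omega> \<and> R (\<omega> (Suc n))}"
    "(\<lambda>\<omega>. restrict \<omega> {1..n}) -` ?V \<inter> space ?M = {\<omega> \<in> space ?M. Q \<omega>}"
    "(\<lambda>\<omega>. restrict \<omega> {Suc n}) -` ?W \<inter> space ?M = {\<omega> \<in> space ?M. R (\<omega> (Suc n))}"
    using decided_after_restrict[OF assms] by (auto simp: PiE_def extensional_def)
  ultimately show ?thesis by simp
qed

lemma first_server_point_prob_range:
  "x \<in> {0..1} \<Longrightarrow> y \<in> {0..1} \<Longrightarrow> first_server_point_prob x y n \<in> {0..1}"
  by (auto simp: first_server_point_prob_def)

lemma prob_next_won:
  assumes "decided_after n Q" "x \<in> {0..1}" "y \<in> {0..1}"
  shows "\<P>(\<omega> in points x y. Q \<omega> \<and> \<omega> (Suc n)) =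
    \<P>(\<omega> in points x y. Q \<omega>) * first_server_point_prob x y (Suc n)"
proof -
  have "{b. b} = {True}" by auto
  then show ?thesis
    using prob_next_point[OF assms(1), of x y "\<lambda>b. b"] prob_point[of "Suc n" x y "\<lambda>b. b"]
      first_server_point_prob_range[OF assms(2,3), of "Suc n"]
    by (simp add: measure_pmf_single)
qed

lemma prob_next_lost:
  assumes "decided_after n Q" "x \<in> {0..1}" "y \<in> {0..1}"
  shows "\<P>(\<omega> in points x y. Q \<omega> \<and> \<not> \<omega> (Suc n)) =
    \<P>(\<omega> in points x y. Q \<omega>) * (1 - first_server_point_prob x y (Suc n))"
proof -
  have "{b. \<not> b} = {False}" by auto
  then show ?thesis
    using prob_next_point[OF assms(1), of x y "\<lambda>b. \<not> b"] prob_point[of "Suc n" x y "\<lambda>b. \<not> b"]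
      first_server_point_prob_range[OF assms(2,3), of "Suc n"]
    by (simp add: measure_pmf_single)
qed

lemma prob_disjoint_decided:
  assumes "decided_after n P" "decided_after n Q" "\<And>\<omega>. \<not> (P \<omega> \<and> Q \<omega>)"
  shows "\<P>(\<omega> in points x y. P \<omega> \<or> Q \<omega>) = \<P>(\<omega> in points x y. P \<omega>) + \<P>(\<omega> in points x y. Q \<omega>)"
proof -
  interpret P: prob_space "points x y" by (rule prob_space_points)
  have "{\<omega> \<in> space (points x y). P \<omega> \<or> Q \<omega>} = {\<omega> \<in> space (points x y). P \<omega>} \<union> {\<omega> \<in> space (points x y). Q \<omega>}"
    by auto
  then show ?thesis
    using assms by (simp add: P.finite_measure_Union decided_after_sets disjoint_iff)
qed

section \<open>The score after a fixed number of points\<close>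

lemma score_A_0 [simp]: "score_A \<omega> 0 = 0"
  by (simp add: score_A_def)

lemma score_A_Suc: "score_A \<omega> (Suc n) = score_A \<omega> n + of_bool (\<omega> (Suc n))"
proof -
  have "{j \<in> {1..Suc n}. \<omega> j} = (if \<omega> (Suc n) then insert (Suc n) {j \<in> {1..n}. \<omega> j} else {j \<in> {1..n}. \<omega> j})"
    by (auto simp: le_Suc_eq)
  then show ?thesis by (simp add: score_A_def)
qed

lemma score_B_0 [simp]: "score_B \<omega> 0 = 0"
  by (simp add: score_B_def)

lemma score_B_Suc: "score_B \<omega> (Suc n) = score_B \<omega> n + of_bool (\<not> \<omega> (Suc n))"
proof -
  have "{j \<in> {1..Suc n}. \<not> \<omega> j} = (if \<not> \<omega> (Suc n) then insert (Suc n) {j \<in> {1..n}. \<not> \<omega> j} else {j \<in> {1..n}. \<not> \<omega> j})"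
    by (auto simp: le_Suc_eq)
  then show ?thesis by (simp add: score_B_def)
qed

lemma score_sum: "score_A \<omega> n + score_B \<omega> n = n"
  by (induction n) (auto simp: score_A_Suc score_B_Suc)

lemma score_A_mono: "m \<le> n \<Longrightarrow> score_A \<omega> m \<le> score_A \<omega> n"
  by (induction n rule: dec_induct) (auto simp: score_A_Suc)

lemma score_B_mono: "m \<le> n \<Longrightarrow> score_B \<omega> m \<le> score_B \<omega> n"
  by (induction n rule: dec_induct) (auto simp: score_B_Suc)

lemma I_A_cases: "I_A n = 0 \<or> I_A n = 1"
  by (simp add: I_A_def)

lemma s_A_Suc: "s_A (Suc n) = s_A n + I_A (Suc n)"
  by (simp add: s_A_def)

lemma s_A_le: "s_A n \<le> n"
proof (induction n)
  case (Suc n) then show ?case using I_A_cases[of "Suc n"] by (auto simp: s_A_Suc)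
qed (simp add: s_A_def)

lemma s_B_Suc: "s_B (Suc n) = s_B n + (1 - I_A (Suc n))"
  using I_A_cases[of "Suc n"] s_A_le[of n] by (auto simp: s_B_def s_A_Suc)

text \<open>
  In \<open>ABBAABBA\<dots>\<close> every aligned pair is \<open>AB\<close> or \<open>BA\<close>. This is why the serving order becomes irrelevant
  after an even number of points.
\<close>

lemma I_A_pair: "I_A (Suc (2 * i)) + I_A (Suc (Suc (2 * i))) = 1"
proof (cases "even i")
  case True
  then obtain j where "i = 2 * j" by blast
  then show ?thesis by (simp add: I_A_def mod_Suc) 
next
  case False
  then obtain j where "i = 2 * j + 1" by (blast elim: oddE)
  then have "Suc (2*i) = 3 + 4*j" "Suc (Suc (2*i)) = 0 + 4 * (j+1)" by auto
  then show ?thesis by (simp only: I_A_def mod_mult_self2) simp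
qed

lemma s_A_even: "s_A (2 * m) = m"
proof (induction m)
  case (Suc m) then show ?case using I_A_pair[of m] by (simp add: s_A_Suc)
qed (simp add: s_A_def)

lemma s_B_even: "s_B (2 * m) = m"
  by (simp add: s_B_def s_A_even)

definition binomial_sum_pmf :: "nat \<Rightarrow> nat \<Rightarrow> real \<Rightarrow> real \<Rightarrow> nat pmf" where
  "binomial_sum_pmf m n p r = map_pmf (\<lambda>(u, v). u + v) (pair_pmf (binomial_pmf m p) (binomial_pmf n r))"

lemma binomial_sum_pmf_commute: "binomial_sum_pmf m n p r = binomial_sum_pmf n m r p"
  unfolding binomial_sum_pmf_def
  by (subst pair_commute_pmf) (auto simp: pmf.map_comp intro!: map_pmf_cong)

lemma pmf_binomial_sum:
  assumes "p \<in> {0..1}" "r \<in> {0..1}"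
  shows "pmf (binomial_sum_pmf m n p r) k =
    (\<Sum>j\<le>k. pmf (binomial_pmf m p) j * pmf (binomial_pmf n r) (k - j))"
proof -
  have "pmf (binomial_sum_pmf m n p r) k =
      measure_pmf.prob (pair_pmf (binomial_pmf m p) (binomial_pmf n r)) ((\<lambda>(u, v). u + v) -` {k})"
    by (simp add: binomial_sum_pmf_def pmf_map)
  also have "(\<lambda>(u, v). u + v) -` {k} = (\<lambda>j. (j, k - j)) ` {..k}"
    by force
  also have "measure_pmf.prob (pair_pmf (binomial_pmf m p) (binomial_pmf n r)) \<dots> =
      (\<Sum>j\<le>k. pmf (binomial_pmf m p) j * pmf (binomial_pmf n r) (k - j))"
    by (subst measure_measure_pmf_finite) (auto simp: sum.reindex inj_on_def pmf_pair)
  finally show ?thesis .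
qed

lemma pmf_binomial_sum_diagonal:
  assumes "p \<in> {0..1}" "r \<in> {0..1}"
  shows "pmf (binomial_sum_pmf k k p r) k =
    (\<Sum>j=0..k. real (k choose j) * real (k choose j) * (p ^ j * (1 - p) ^ (k - j)) * (r ^ (k - j) * (1 - r) ^ j))"
  unfolding pmf_binomial_sum[OF assms] atLeast0AtMost
proof (rule sum.cong)
  fix j assume "j \<in> {..k}"
  then have "k - (k - j) = j" "k choose (k - j) = k choose j"
    by (simp_all add: binomial_symmetric[symmetric])
  then show "pmf (binomial_pmf k p) j * pmf (binomial_pmf k r) (k - j) =
      real (k choose j) * real (k choose j) * (p ^ j * (1 - p) ^ (k - j)) * (r ^ (k - j) * (1 - r) ^ j)"
    using assms by simp
qed simp

lemma pmf_binomial_sum_Suc_left: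
  assumes "p \<in> {0..1}"
  shows "pmf (binomial_sum_pmf (Suc m) n p r) k =
    (if k = 0 then 0 else pmf (binomial_sum_pmf m n p r) (k - 1) * p) + pmf (binomial_sum_pmf m n p r) k * (1 - p)"
proof -
  let ?D = "binomial_sum_pmf m n p r"
  have "binomial_sum_pmf (Suc m) n p r = bernoulli_pmf p \<bind> (\<lambda>b. map_pmf ((+) (of_bool b)) ?D)"
    unfolding binomial_sum_pmf_def pair_pmf_def binomial_pmf_Suc[OF assms]
    by (auto simp: map_pmf_def bind_assoc_pmf bind_return_pmf add.assoc intro!: bind_pmf_cong)
  moreover have "pmf (map_pmf ((+) 1) ?D) k = (if k = 0 then 0 else pmf ?D (k - 1))"
  proof (cases k)
    case 0 then show ?thesis by (simp add: pmf_map vimage_def)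
  next
    case (Suc l)
    then have "((+) 1) -` {k} = {l}" by auto
    then show ?thesis using Suc by (simp add: pmf_map measure_pmf_single)
  qed
  moreover have "map_pmf ((+) 0) ?D = ?D" by (simp add: map_pmf_idI)
  ultimately show ?thesis using assms by (simp add: pmf_bind)
qed

lemma pmf_binomial_sum_Suc_right:
  assumes "r \<in> {0..1}"
  shows "pmf (binomial_sum_pmf m (Suc n) p r) k =
    (if k = 0 then 0 else pmf (binomial_sum_pmf m n p r) (k - 1) * r) + pmf (binomial_sum_pmf m n p r) k * (1 - r)"
  using pmf_binomial_sum_Suc_left[OF assms, of n m p k]
  by (simp add: binomial_sum_pmf_commute[of _ m] binomial_sum_pmf_commute[of _ _ r p])

text \<open>
  Each new point adds an independent Bernoulli variable, which joins the binomial variable belonging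
  to its server: \<open>A\<close> wins a point served by \<open>B\<close> with probability \<open>1 - y\<close>.
\<close>

lemma prob_score_A:
  assumes "x \<in> {0..1}" "y \<in> {0..1}"
  shows "\<P>(\<omega> in points x y. score_A \<omega> n = k) = pmf (binomial_sum_pmf (s_A n) (s_B n) x (1 - y)) k"
proof (induction n arbitrary: k)
  case 0
  interpret P: prob_space "points x y" by (rule prob_space_points)
  have "binomial_sum_pmf (s_A 0) (s_B 0) x (1 - y) = return_pmf 0"
    using assms by (simp add: s_A_def s_B_def binomial_sum_pmf_def binomial_pmf_0 pair_pmf_def bind_return_pmf)
  then show ?case by (cases "k = 0") (auto simp: P.prob_space)
next
  case (Suc n)
  let ?D = "binomial_sum_pmf (s_A n) (s_B n) x (1 - y)" and ?p = "first_server_point_prob x y (Suc n)"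
  have "\<P>(\<omega> in points x y. score_A \<omega> (Suc n) = k) =
      \<P>(\<omega> in points x y. (score_A \<omega> n + 1 = k \<and> \<omega> (Suc n)) \<or> (score_A \<omega> n = k \<and> \<not> \<omega> (Suc n)))"
    by (intro arg_cong[where f="measure _"] Collect_cong) (auto simp: score_A_Suc)
  also have "\<dots> = \<P>(\<omega> in points x y. score_A \<omega> n + 1 = k \<and> \<omega> (Suc n)) +
      \<P>(\<omega> in points x y. score_A \<omega> n = k \<and> \<not> \<omega> (Suc n))"
    by (intro prob_disjoint_decided[where n="Suc n"] decided_after_conj
        decided_after_score_A[where R="\<lambda>a. a + 1 = k"] decided_after_score_A[where R="\<lambda>a. a = k"]
        decided_after_point[where R="\<lambda>b. b"] decided_after_point[where R="\<lambda>b. \<not> b"]) auto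
  also have "\<dots> = \<P>(\<omega> in points x y. score_A \<omega> n + 1 = k) * ?p + \<P>(\<omega> in points x y. score_A \<omega> n = k) * (1 - ?p)"
    using assms prob_next_won[OF decided_after_score_A[where R="\<lambda>a. a + 1 = k" and m=n and n=n]]
      prob_next_lost[OF decided_after_score_A[where R="\<lambda>a. a = k" and m=n and n=n]]
    by simp
  also have "\<P>(\<omega> in points x y. score_A \<omega> n + 1 = k) = (if k = 0 then 0 else pmf ?D (k - 1))"
    using Suc.IH[of "k - 1"] by (cases k) auto
  also have "\<P>(\<omega> in points x y. score_A \<omega> n = k) = pmf ?D k"
    by (rule Suc.IH)
  finally have *: "\<P>(\<omega> in points x y. score_A \<omega> (Suc n) = k) =
      (if k = 0 then 0 else pmf ?D (k - 1)) * ?p + pmf ?D k * (1 - ?p)" .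
  show ?case
    using I_A_cases[of "Suc n"]
  proof
    assume "I_A (Suc n) = 1"
    then show ?thesis using assms unfolding *
      by (simp add: s_A_Suc s_B_Suc first_server_point_prob_def pmf_binomial_sum_Suc_left)
  next
    assume "I_A (Suc n) = 0"
    then show ?thesis using assms unfolding *
      by (simp add: s_A_Suc s_B_Suc first_server_point_prob_def pmf_binomial_sum_Suc_right)
  qed
qed

text \<open>
  Passing to the complement \<open>{..<k}\<close> reduces the claim to a finite sum of point probabilities.
\<close>

lemma prob_score_A_ge:
  assumes "x \<in> {0..1}" "y \<in> {0..1}"
  shows "\<P>(\<omega> in points x y. k \<le> score_A \<omega> n) =
    measure_pmf.prob (binomial_sum_pmf (s_A n) (s_B n) x (1 - y)) {k..}"
proof -
  let ?M = "points x y" and ?D = "binomial_sum_pmf (s_A n) (s_B n) x (1 - y)"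
  interpret P: prob_space ?M by (rule prob_space_points)
  have lt: "\<P>(\<omega> in ?M. score_A \<omega> n < k) = measure_pmf.prob ?D {..<k}"
  proof (induction k)
    case (Suc k)
    have "\<P>(\<omega> in ?M. score_A \<omega> n < Suc k) = \<P>(\<omega> in ?M. score_A \<omega> n < k \<or> score_A \<omega> n = k)"
      by (simp add: less_Suc_eq)
    also have "\<dots> = \<P>(\<omega> in ?M. score_A \<omega> n < k) + \<P>(\<omega> in ?M. score_A \<omega> n = k)"
      by (intro prob_disjoint_decided[where n=n]
          decided_after_score_A[where R="\<lambda>a. a < k"] decided_after_score_A[where R="\<lambda>a. a = k"]) auto
    finally show ?case
      by (simp add: Suc.IH prob_score_A[OF assms] measure_measure_pmf_finite)
  qed simp
  have "{\<omega> \<in> space ?M. k \<le> score_A \<omega> n} = space ?M - {\<omega> \<in> space ?M. score_A \<omega> n < k}"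
    by auto
  moreover have "{\<omega> \<in> space ?M. score_A \<omega> n < k} \<in> P.events"
    by (rule decided_after_sets[OF decided_after_score_A[where R="\<lambda>a. a < k" and m=n and n=n]]) simp
  ultimately have "\<P>(\<omega> in ?M. k \<le> score_A \<omega> n) = 1 - measure_pmf.prob ?D {..<k}"
    by (simp add: P.prob_compl lt)
  also have "\<dots> = measure_pmf.prob ?D {k..}"
    using measure_pmf.prob_compl[of "{..<k}" ?D] by (simp add: Compl_eq_Diff_UNIV[symmetric])
  finally show ?thesis .
qed

section \<open>How the first server wins\<close>

text \<open>
  With at most \<open>K - 2\<close> points for the opponent, the game ends as soon as \<open>A\<close> has \<open>K\<close> points. So it ends at
  score \<open>(K, h)\<close> exactly when \<open>A\<close> gets the \<open>K\<close>th point as point number \<open>K + h\<close>.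
\<close>

lemma ST_win_iff:
  assumes "h + 2 \<le> K"
  shows "(\<exists>n. A_wins_at (ST_rule K) \<omega> n \<and> score_A \<omega> n = K \<and> score_B \<omega> n = h) \<longleftrightarrow>
    score_A \<omega> (K + h - 1) = K - 1 \<and> \<omega> (K + h)"
proof -
  obtain l where l: "K + h = Suc l" using assms by (cases "K + h") auto
  have "(\<exists>n. A_wins_at (ST_rule K) \<omega> n \<and> score_A \<omega> n = K \<and> score_B \<omega> n = h) \<longleftrightarrow>
    score_A \<omega> l = K - 1 \<and> \<omega> (Suc l)" (is "?L \<longleftrightarrow> ?R")
  proof
    assume ?L
    then obtain n where n: "in_play (ST_rule K) \<omega> n" "score_A \<omega> n = K" "score_B \<omega> n = h"
      by (auto simp: A_wins_at_def)
    have "n = Suc l" using n score_sum[of \<omega> n] l by simp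
    moreover have "\<omega> (Suc l)"
    proof (rule ccontr)
      assume "\<not> \<omega> (Suc l)"
      then have "ST_rule K (score_A \<omega> l) (score_B \<omega> l)"
        using n assms \<open>n = Suc l\<close> by (auto simp: score_A_Suc score_B_Suc ST_rule_def)
      then show False using n(1) \<open>n = Suc l\<close> by (auto simp: in_play_def)
    qed
    ultimately show ?R using n(2) by (auto simp: score_A_Suc)
  next
    assume ?R
    then have A: "score_A \<omega> l = K - 1" "\<omega> (Suc l)" by blast+
    then have AK: "score_A \<omega> (Suc l) = K" using assms by (simp add: score_A_Suc)
    then have B: "score_B \<omega> (Suc l) = h" using score_sum[of \<omega> "Suc l"] l by simp
    have "score_A \<omega> m < K \<and> score_B \<omega> m < K" if "m < Suc l" for m
      using score_A_mono[of m l \<omega>] score_B_mono[of m "Suc l" \<omega>] that A B assms by simp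
    then have "in_play (ST_rule K) \<omega> (Suc l)" by (force simp: in_play_def ST_rule_def)
    then show ?L using AK B assms by (auto simp: A_wins_at_def ST_rule_def intro!: exI[of _ "Suc l"])
  qed
  then show ?thesis unfolding l diff_Suc_1 .
qed

text \<open>
  If \<open>A\<close> gets \<open>K\<close> points at all within \<open>2 * (K - 1)\<close> points, the first time this happens is after
  \<open>K + h\<close> points for some \<open>h \<le> K - 2\<close>. This turns the sum over final scores into one event about the
  score at a fixed time.
\<close>

lemma score_A_reaches_iff:
  assumes "1 \<le> K"
  shows "(\<exists>h<K - 1. score_A \<omega> (K + h - 1) = K - 1 \<and> \<omega> (K + h)) \<longleftrightarrow> K \<le> score_A \<omega> (2 * (K - 1))"
proof
  assume "\<exists>h<K - 1. score_A \<omega> (K + h - 1) = K - 1 \<and> \<omega> (K + h)"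
  then obtain h where h: "h < K - 1" "score_A \<omega> (K + h - 1) = K - 1" "\<omega> (K + h)" by blast
  then have "score_A \<omega> (K + h) = K" using score_A_Suc[of \<omega> "K + h - 1"] assms by simp
  then show "K \<le> score_A \<omega> (2 * (K - 1))" using score_A_mono[of "K + h" "2 * (K - 1)" \<omega>] h by simp
next
  assume L: "K \<le> score_A \<omega> (2 * (K - 1))"
  define n where "n = (LEAST n. K \<le> score_A \<omega> n)"
  have n: "K \<le> score_A \<omega> n" "n \<le> 2 * (K - 1)" unfolding n_def using L by (auto intro: LeastI Least_le)
  have "K \<le> n" using n score_sum[of \<omega> n] by simp
  then obtain l where l: "n = Suc l" using assms by (cases n) auto
  have "\<not> K \<le> score_A \<omega> l" using not_less_Least[of l "\<lambda>n. K \<le> score_A \<omega> n"] l by (simp add: n_def)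
  then have "score_A \<omega> l = K - 1 \<and> \<omega> (Suc l)"
    using n(1) by (cases "\<omega> (Suc l)") (auto simp: l score_A_Suc)
  then show "\<exists>h<K - 1. score_A \<omega> (K + h - 1) = K - 1 \<and> \<omega> (K + h)"
    using \<open>K \<le> n\<close> n(2) assms l by (intro exI[of _ "n - K"]) auto
qed

lemma ST_reach_iff:
  assumes "1 \<le> K"
  shows "(\<exists>n. in_play (ST_rule K) \<omega> n \<and> score_A \<omega> n = K - 1 \<and> score_B \<omega> n = K - 1) \<longleftrightarrow>
    score_A \<omega> (2 * (K - 1)) = K - 1" (is "?L \<longleftrightarrow> ?R")
proof
  assume ?L
  then obtain n where n: "score_A \<omega> n = K - 1" "score_B \<omega> n = K - 1" by blast
  moreover have "n = 2 * (K - 1)" using n score_sum[of \<omega> n] by simp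
  ultimately show ?R by simp
next
  assume A: ?R
  then have B: "score_B \<omega> (2 * (K - 1)) = K - 1" using score_sum[of \<omega> "2 * (K - 1)"] by simp
  have "score_A \<omega> m < K \<and> score_B \<omega> m < K" if "m < 2 * (K - 1)" for m
    using score_A_mono[of m "2 * (K - 1)" \<omega>] score_B_mono[of m "2 * (K - 1)" \<omega>] that A B assms by linarith
  then have "in_play (ST_rule K) \<omega> (2 * (K - 1))" by (force simp: in_play_def ST_rule_def)
  then show ?L using A B by blast
qed

text \<open>
  Pair \<open>i\<close> consists of the points \<open>2 i + 1\<close> and \<open>2 i + 2\<close>.
\<close>

definition pair_split :: "(nat \<Rightarrow> bool) \<Rightarrow> nat \<Rightarrow> bool" where
  "pair_split \<omega> i \<longleftrightarrow> \<omega> (Suc (2 * i)) \<noteq> \<omega> (Suc (Suc (2 * i)))"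

definition pair_won :: "(nat \<Rightarrow> bool) \<Rightarrow> nat \<Rightarrow> bool" where
  "pair_won \<omega> i \<longleftrightarrow> \<omega> (Suc (2 * i)) \<and> \<omega> (Suc (Suc (2 * i)))"

lemma level_after_split_pairs:
  assumes "c \<le> m" "score_A \<omega> (2 * c) = c" "\<forall>i\<in>{c..<m}. pair_split \<omega> i"
  shows "score_A \<omega> (2 * m) = m" "score_B \<omega> (2 * m) = m"
proof -
  show *: "score_A \<omega> (2 * m) = m" using assms
  proof (induction m rule: dec_induct)
    case (step m)
    then have "score_A \<omega> (2 * m) = m" "pair_split \<omega> m" by auto
    then show ?case by (auto simp: score_A_Suc pair_split_def)
  qed
  then show "score_B \<omega> (2 * m) = m" using score_sum[of \<omega> "2 * m"] by simp
qed

text \<open>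
  While pairs are split, the score is level after even numbers of points and differs by one after odd
  ones, so nobody has a lead of two; before the level score nobody has \<open>K\<close> points. The bound
  \<open>2 m + 2\<close> includes pair \<open>m\<close>, of which nothing is assumed: its first point alone cannot decide.
\<close>

lemma in_play_while_pairs_split:
  assumes "1 \<le> K" "K - 1 \<le> m" and level: "score_A \<omega> (2 * (K - 1)) = K - 1"
    and split: "\<forall>i\<in>{K - 1..<m}. pair_split \<omega> i"
  shows "in_play (ST_rule K) \<omega> (2 * m + 2)"
proof -
  have "\<not> ST_rule K (score_A \<omega> n) (score_B \<omega> n) \<and> \<not> ST_rule K (score_B \<omega> n) (score_A \<omega> n)"
    if n: "n < 2 * m + 2" for n
  proof (cases "n < 2 * (K - 1)")
    case True
    then have "score_A \<omega> n < K" "score_B \<omega> n < K"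
      using score_A_mono[of n "2 * (K - 1)" \<omega>] score_B_mono[of n "2 * (K - 1)" \<omega>] level
        score_sum[of \<omega> "2 * (K - 1)"] \<open>1 \<le> K\<close> by auto
    then show ?thesis by (simp add: ST_rule_def)
  next
    case False
    define i where "i = n div 2"
    have i: "K - 1 \<le> i" "i \<le> m" "n = 2 * i \<or> n = Suc (2 * i)" using False n unfolding i_def by linarith+
    have "\<forall>j\<in>{K - 1..<i}. pair_split \<omega> j" using split i(2) by auto
    note L = level_after_split_pairs[OF i(1) level this]
    show ?thesis using i(3) L by (auto simp: ST_rule_def score_A_Suc score_B_Suc of_bool_def split: if_splits)
  qed
  then show ?thesis by (simp add: in_play_def)
qed

text \<open>
  After \<open>2 * (K - 1)\<close> points, a player who has \<open>K\<close> points leads by at least two, so the game is over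
  unless the score is level.
\<close>

lemma A_wins_ST_iff:
  assumes K: "1 \<le> K"
  shows "(\<exists>n. A_wins_at (ST_rule K) \<omega> n) \<longleftrightarrow> K \<le> score_A \<omega> (2 * (K - 1)) \<or>
    score_A \<omega> (2 * (K - 1)) = K - 1 \<and>
      (\<exists>m. (\<forall>i\<in>{K - 1..<K - 1 + m}. pair_split \<omega> i) \<and> pair_won \<omega> (K - 1 + m))"
  (is "?L \<longleftrightarrow> ?lead \<or> ?level \<and> ?R")
proof -
  consider "K \<le> score_A \<omega> (2 * (K - 1))" | "score_A \<omega> (2 * (K - 1)) = K - 1" | "score_A \<omega> (2 * (K - 1)) < K - 1"
    by linarith
  then show ?thesis
  proof cases
    (* A has already won, at the moment of reaching K points. *)
    case 1
    then obtain h where "h < K - 1" "score_A \<omega> (K + h - 1) = K - 1 \<and> \<omega> (K + h)"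
      using score_A_reaches_iff[OF K, of \<omega>] by blast
    then have "\<exists>n. A_wins_at (ST_rule K) \<omega> n \<and> score_A \<omega> n = K \<and> score_B \<omega> n = h"
      by (subst ST_win_iff) auto
    then have ?L by blast
    then show ?thesis using 1 by simp
  next
    (* Level: the first pair that is not split decides. *)
    case 2
    have "?L \<longleftrightarrow> ?R"
    proof
      assume ?L
      then obtain n where n: "in_play (ST_rule K) \<omega> n" "ST_rule K (score_A \<omega> n) (score_B \<omega> n)"
        by (auto simp: A_wins_at_def)
      have unsplit: "\<exists>i\<ge>K - 1. \<not> pair_split \<omega> i"
      proof (rule ccontr)
        assume "\<not> ?thesis"
        then have "in_play (ST_rule K) \<omega> (2 * (K + n) + 2)"
          by (intro in_play_while_pairs_split[OF K _ 2]) auto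
        then show False using n(2) by (simp add: in_play_def)
      qed
      define m where "m = (LEAST i. K - 1 \<le> i \<and> \<not> pair_split \<omega> i)"
      have m: "K - 1 \<le> m" "\<not> pair_split \<omega> m"
        using LeastI_ex[OF unsplit[simplified]] unfolding m_def by auto
      have split: "\<forall>i\<in>{K - 1..<m}. pair_split \<omega> i"
        using not_less_Least unfolding m_def by fastforce
      note L = level_after_split_pairs[OF m(1) 2 split]
      have "2 * m + 2 \<le> n"
        using in_play_while_pairs_split[OF K m(1) 2 split] n(2) by (force simp: in_play_def not_le[symmetric])
      have "pair_won \<omega> m"
      proof (rule ccontr)
        assume "\<not> pair_won \<omega> m"
        then have s: "score_A \<omega> (2 * m + 2) = m" "score_B \<omega> (2 * m + 2) = m + 2"
          using m(2) L by (auto simp: pair_won_def pair_split_def score_A_Suc score_B_Suc)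
        show False
        proof (cases "n = 2 * m + 2")
          case True then show False using n(2) s by (simp add: ST_rule_def)
        next
          case False
          then have "\<not> ST_rule K (score_B \<omega> (2 * m + 2)) (score_A \<omega> (2 * m + 2))"
            using n(1) \<open>2 * m + 2 \<le> n\<close> unfolding in_play_def by (metis le_neq_implies_less)
          then show False using s m(1) by (simp add: ST_rule_def)
        qed
      qed
      then show ?R using split m(1) by (intro exI[of _ "m - (K - 1)"]) auto
    next
      assume ?R
      then obtain r where r: "\<forall>i\<in>{K - 1..<K - 1 + r}. pair_split \<omega> i" "pair_won \<omega> (K - 1 + r)" by blast
      define m where "m = K - 1 + r"
      have m: "K - 1 \<le> m" "\<forall>i\<in>{K - 1..<m}. pair_split \<omega> i" "pair_won \<omega> m" using r by (auto simp: m_def)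
      note L = level_after_split_pairs[OF m(1) 2 m(2)]
      have "ST_rule K (score_A \<omega> (2 * m + 2)) (score_B \<omega> (2 * m + 2))"
        using L m by (auto simp: pair_won_def score_A_Suc score_B_Suc ST_rule_def)
      then show ?L using in_play_while_pairs_split[OF K m(1) 2 m(2)] by (auto simp: A_wins_at_def)
    qed
    moreover have "\<not> ?lead" using 2 K by linarith
    ultimately show ?thesis using 2 by blast
  next
    (* The other player satisfies the winning rule, while A still has too few points. *)
    case 3
    have "\<not> ?L"
    proof
      assume ?L
      then obtain n where n: "in_play (ST_rule K) \<omega> n" "ST_rule K (score_A \<omega> n) (score_B \<omega> n)"
        by (auto simp: A_wins_at_def)
      have "ST_rule K (score_B \<omega> (2 * (K - 1))) (score_A \<omega> (2 * (K - 1)))"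
        using 3 score_sum[of \<omega> "2 * (K - 1)"] by (simp add: ST_rule_def)
      then have "n \<le> 2 * (K - 1)" using n(1) by (force simp: in_play_def not_le[symmetric])
      then show False using score_A_mono[of n "2 * (K - 1)" \<omega>] 3 n(2) unfolding ST_rule_def by linarith
    qed
    then show ?thesis using 3 by simp
  qed
qed

section \<open>Winning from a level score\<close>

lemma prob_next_pair:
  assumes "decided_after (2 * i) Q" "x \<in> {0..1}" "y \<in> {0..1}"
  shows "\<P>(\<omega> in points x y. Q \<omega> \<and> pair_won \<omega> i) = \<P>(\<omega> in points x y. Q \<omega>) * (x * (1 - y))"
    and "\<P>(\<omega> in points x y. Q \<omega> \<and> pair_split \<omega> i) = \<P>(\<omega> in points x y. Q \<omega>) * (x * y + (1 - x) * (1 - y))"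
proof -
  let ?M = "points x y" and ?a = "Suc (2 * i)"
  let ?p = "first_server_point_prob x y ?a" and ?r = "first_server_point_prob x y (Suc ?a)"
  (* The two serves come in either order, and both orders give the same products below. *)
  have pr: "?p = x \<and> ?r = 1 - y \<or> ?p = 1 - y \<and> ?r = x"
    using I_A_pair[of i] I_A_cases[of ?a] by (auto simp: first_server_point_prob_def)
  have Qa: "decided_after ?a (\<lambda>\<omega>. Q \<omega> \<and> \<omega> ?a)" "decided_after ?a (\<lambda>\<omega>. Q \<omega> \<and> \<not> \<omega> ?a)"
    by (intro decided_after_conj decided_after_mono[OF assms(1)]
        decided_after_point[where R="\<lambda>b. b"] decided_after_point[where R="\<lambda>b. \<not> b"]; simp)+
  have "\<P>(\<omega> in ?M. (Q \<omega> \<and> \<omega> ?a) \<and> \<omega> (Suc ?a)) = \<P>(\<omega> in ?M. Q \<omega>) * ?p * ?r"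
    using assms by (subst prob_next_won[OF Qa(1)]) (simp_all add: prob_next_won)
  then show "\<P>(\<omega> in ?M. Q \<omega> \<and> pair_won \<omega> i) = \<P>(\<omega> in ?M. Q \<omega>) * (x * (1 - y))"
    using pr by (auto simp: pair_won_def conj_assoc)
  have "\<P>(\<omega> in ?M. Q \<omega> \<and> pair_split \<omega> i) =
      \<P>(\<omega> in ?M. ((Q \<omega> \<and> \<omega> ?a) \<and> \<not> \<omega> (Suc ?a)) \<or> ((Q \<omega> \<and> \<not> \<omega> ?a) \<and> \<omega> (Suc ?a)))"
    by (intro arg_cong[where f="measure _"] Collect_cong) (auto simp: pair_split_def)
  also have "\<dots> = \<P>(\<omega> in ?M. (Q \<omega> \<and> \<omega> ?a) \<and> \<not> \<omega> (Suc ?a)) + \<P>(\<omega> in ?M. (Q \<omega> \<and> \<not> \<omega> ?a) \<and> \<omega> (Suc ?a))"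
    by (intro prob_disjoint_decided[where n="Suc ?a"] decided_after_conj[of _ _ "\<lambda>\<omega>. \<omega> (Suc ?a)"]
        decided_after_conj[of _ _ "\<lambda>\<omega>. \<not> \<omega> (Suc ?a)"] decided_after_mono[OF Qa(1)] decided_after_mono[OF Qa(2)]
        decided_after_point[where R="\<lambda>b. b"] decided_after_point[where R="\<lambda>b. \<not> b"]) auto
  also have "\<P>(\<omega> in ?M. (Q \<omega> \<and> \<omega> ?a) \<and> \<not> \<omega> (Suc ?a)) = \<P>(\<omega> in ?M. Q \<omega>) * ?p * (1 - ?r)"
    using assms by (subst prob_next_lost[OF Qa(1)]) (simp_all add: prob_next_won)
  also have "\<P>(\<omega> in ?M. (Q \<omega> \<and> \<not> \<omega> ?a) \<and> \<omega> (Suc ?a)) = \<P>(\<omega> in ?M. Q \<omega>) * (1 - ?p) * ?r"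
    using assms by (subst prob_next_won[OF Qa(2)]) (simp_all add: prob_next_lost)
  also have "\<P>(\<omega> in ?M. Q \<omega>) * ?p * (1 - ?r) + \<P>(\<omega> in ?M. Q \<omega>) * (1 - ?p) * ?r =
      \<P>(\<omega> in ?M. Q \<omega>) * (?p * (1 - ?r) + (1 - ?p) * ?r)"
    by (simp only: distrib_left mult.assoc)
  also have "?p * (1 - ?r) + (1 - ?p) * ?r = x * y + (1 - x) * (1 - y)"
    using pr by (elim disjE conjE) (simp_all only:, simp_all add: algebra_simps)
  finally show "\<P>(\<omega> in ?M. Q \<omega> \<and> pair_split \<omega> i) = \<P>(\<omega> in ?M. Q \<omega>) * (x * y + (1 - x) * (1 - y))" .
qed

lemma decided_after_pair_split: "i < m \<Longrightarrow> decided_after (2 * m) (\<lambda>\<omega>. pair_split \<omega> i)"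
  by (simp add: decided_after_def pair_split_def)

lemma decided_after_pair_won: "i < m \<Longrightarrow> decided_after (2 * m) (\<lambda>\<omega>. pair_won \<omega> i)"
  by (simp add: decided_after_def pair_won_def)

text \<open>
  This is the probability that, given that the players do not split a pair, the first server is the
  one to win both of its points.
\<close>

definition STT_prob :: "real \<Rightarrow> real \<Rightarrow> real" where
  "STT_prob x y = x * (1 - y) / (x * (1 - y) + y * (1 - x))"

lemma STT_prob_denominator_pos:
  fixes x y :: real
  assumes "x \<in> {0..1}" "y \<in> {0..1}" "\<not> (x = 0 \<and> y = 0)" "\<not> (x = 1 \<and> y = 1)"
  shows "0 < x * (1 - y) + y * (1 - x)"
proof -
  have nn: "0 \<le> x * (1 - y)" "0 \<le> y * (1 - x)"
    using assms(1,2) by simp_all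
  have "x * (1 - y) \<noteq> 0 \<or> y * (1 - x) \<noteq> 0" using assms by auto
  then show ?thesis using nn by linarith
qed

lemma STT_prob_swap:
  assumes "x \<in> {0..1}" "y \<in> {0..1}" "\<not> (x = 0 \<and> y = 0)" "\<not> (x = 1 \<and> y = 1)"
  shows "1 - STT_prob y x = STT_prob x y"
proof -
  have "STT_prob x y + STT_prob y x = 1"
    using STT_prob_denominator_pos[OF assms]
    by (simp add: STT_prob_def add.commute[of "y * (1 - x)"] add_divide_distrib[symmetric])
  then show ?thesis by simp
qed

text \<open>
  Let \<open>t\<close> be the probability that a pair is split. The events \<open>pairs c, \<dots>, c + m - 1 are split and A wins
  both points of pair c + m\<close> are disjoint for different \<open>m\<close>, and have probability
  \<open>t ^ m * (x * (1 - y))\<close>, independently of the first \<open>2 * c\<close> points. The geometric series has the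
  value claimed because \<open>1 - t = x * (1 - y) + y * (1 - x)\<close>. Keeping an arbitrary earlier event \<open>Q\<close> in the
  statement avoids conditioning on the level score and shifting the product measure.
\<close>

lemma prob_level_then_ahead:
  assumes x: "x \<in> {0..1}" and y: "y \<in> {0..1}" and "\<not> (x = 0 \<and> y = 0)" "\<not> (x = 1 \<and> y = 1)"
    and Q: "decided_after (2 * c) Q"
  shows "\<P>(\<omega> in points x y. \<exists>m. Q \<omega> \<and> (\<forall>i\<in>{c..<c + m}. pair_split \<omega> i) \<and> pair_won \<omega> (c + m)) =
      \<P>(\<omega> in points x y. Q \<omega>) * STT_prob x y" (is "?P = ?q * _")
    and "{\<omega> \<in> space (points x y). \<exists>m. Q \<omega> \<and> (\<forall>i\<in>{c..<c + m}. pair_split \<omega> i) \<and> pair_won \<omega> (c + m)}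
      \<in> sets (points x y)"
proof -
  let ?M = "points x y" and ?t = "x * y + (1 - x) * (1 - y)" and ?a = "x * (1 - y)"
  interpret P: prob_space ?M by (rule prob_space_points)
  define S where "S m \<omega> \<longleftrightarrow> Q \<omega> \<and> (\<forall>i\<in>{c..<c + m}. pair_split \<omega> i)" for m \<omega>
  define E where "E m = {\<omega> \<in> space ?M. S m \<omega> \<and> pair_won \<omega> (c + m)}" for m
  have decS: "decided_after (2 * (c + m)) (S m)" for m
    unfolding S_def
    by (intro decided_after_conj decided_after_mono[OF Q] decided_after_Ball decided_after_pair_split) auto
  have probS: "\<P>(\<omega> in ?M. S m \<omega>) = ?q * ?t ^ m" for m
  proof (induction m)
    case (Suc m)
    have "{c..<c + Suc m} = insert (c + m) {c..<c + m}" by auto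
    then have "\<P>(\<omega> in ?M. S (Suc m) \<omega>) = \<P>(\<omega> in ?M. S m \<omega> \<and> pair_split \<omega> (c + m))"
      by (intro arg_cong[where f="measure _"] Collect_cong) (auto simp: S_def)
    also have "\<dots> = \<P>(\<omega> in ?M. S m \<omega>) * ?t"
      by (rule prob_next_pair(2)[OF decS x y])
    finally show ?case by (simp add: Suc.IH)
  qed (simp add: S_def)
  have probE: "P.prob (E m) = ?q * ?t ^ m * ?a" for m
    unfolding E_def by (subst prob_next_pair(1)[OF decS x y]) (simp add: probS)
  have setsE: "range E \<subseteq> sets ?M"
  proof safe
    fix m
    have "decided_after (2 * Suc (c + m)) (\<lambda>\<omega>. S m \<omega> \<and> pair_won \<omega> (c + m))"
      by (intro decided_after_conj decided_after_mono[OF decS] decided_after_pair_won) auto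
    then show "E m \<in> sets ?M" unfolding E_def by (rule decided_after_sets)
  qed
  have disjE: "disjoint_family E"
  proof -
    have "\<not> (S m \<omega> \<and> pair_won \<omega> (c + m) \<and> S m' \<omega>)" if "m < m'" for m m' \<omega>
    proof
      assume "S m \<omega> \<and> pair_won \<omega> (c + m) \<and> S m' \<omega>"
      moreover have "c + m \<in> {c..<c + m'}" using that by simp
      ultimately have "pair_won \<omega> (c + m)" "pair_split \<omega> (c + m)" unfolding S_def by blast+
      then show False by (simp add: pair_won_def pair_split_def)
    qed
    then show ?thesis unfolding disjoint_family_on_def E_def by (auto, metis linorder_neqE_nat)
  qed
  have UnE: "{\<omega> \<in> space ?M. \<exists>m. Q \<omega> \<and> (\<forall>i\<in>{c..<c + m}. pair_split \<omega> i) \<and> pair_won \<omega> (c + m)} = (\<Union>m. E m)"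
    by (auto simp: E_def S_def)
  have t: "1 - ?t = x * (1 - y) + y * (1 - x)" by (simp add: algebra_simps)
  moreover have "0 \<le> x * y" "0 \<le> (1 - x) * (1 - y)" using x y by simp_all
  ultimately have "norm ?t < 1" using STT_prob_denominator_pos[OF assms(1-4)] unfolding real_norm_def by linarith
  then have "(\<lambda>m. ?q * ?a * ?t ^ m) sums (?q * ?a * (1 / (1 - ?t)))"
    by (intro sums_mult geometric_sums)
  moreover have "(\<lambda>m. ?q * ?a * ?t ^ m) = (\<lambda>m. P.prob (E m))"
    by (simp add: probE fun_eq_iff)
  ultimately have "(\<lambda>m. P.prob (E m)) sums (?q * ?a * (1 / (1 - ?t)))"
    by simp
  moreover have "(\<lambda>m. P.prob (E m)) sums P.prob (\<Union>m. E m)"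
    by (rule P.finite_measure_UNION[OF setsE disjE])
  ultimately have "P.prob (\<Union>m. E m) = ?q * ?a * (1 / (1 - ?t))"
    by (rule sums_unique2[symmetric])
  then show "?P = ?q * STT_prob x y"
    unfolding UnE STT_prob_def t by simp
  show "{\<omega> \<in> space ?M. \<exists>m. Q \<omega> \<and> (\<forall>i\<in>{c..<c + m}. pair_split \<omega> i) \<and> pair_won \<omega> (c + m)} \<in> sets ?M"
    unfolding UnE using setsE by blast
qed

section \<open>The probabilities of the set tie-breaker\<close>

lemma ST_prob_eq:
  assumes K: "1 \<le> K" and x: "x \<in> {0..1}" and y: "y \<in> {0..1}"
    and "\<not> (x = 0 \<and> y = 0)" "\<not> (x = 1 \<and> y = 1)"
  shows "\<theta>_ST x y K = measure_pmf.prob (binomial_sum_pmf (K - 1) (K - 1) x (1 - y)) {K..}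
      + pmf (binomial_sum_pmf (K - 1) (K - 1) x (1 - y)) (K - 1) * STT_prob x y"
proof -
  let ?M = "points x y" and ?n = "2 * (K - 1)"
  let ?E = "{\<omega> \<in> space ?M. K \<le> score_A \<omega> ?n}"
  let ?F = "{\<omega> \<in> space ?M. \<exists>m. score_A \<omega> ?n = K - 1 \<and> (\<forall>i\<in>{K - 1..<K - 1 + m}. pair_split \<omega> i)
      \<and> pair_won \<omega> (K - 1 + m)}"
  interpret P: prob_space ?M by (rule prob_space_points)
  have level: "decided_after ?n (\<lambda>\<omega>. score_A \<omega> ?n = K - 1)"
    by (rule decided_after_score_A[where R="\<lambda>a. a = K - 1"]) simp
  note F = prob_level_then_ahead[OF assms(2-5) level]
  have "?E \<in> sets ?M"
    by (rule decided_after_sets[OF decided_after_score_A[where R="\<lambda>a. K \<le> a" and m="?n" and n="?n"]]) simp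
  moreover have "{\<omega> \<in> space ?M. \<exists>n. A_wins_at (ST_rule K) \<omega> n} = ?E \<union> ?F"
    unfolding A_wins_ST_iff[OF K] by auto
  moreover have "?E \<inter> ?F = {}" using K by auto
  ultimately have "\<theta>_ST x y K = P.prob ?E + P.prob ?F"
    unfolding \<theta>_ST_def using F(2) by (simp add: P.finite_measure_Union)
  then show ?thesis
    unfolding F(1) prob_score_A_ge[OF x y] prob_score_A[OF x y] s_A_even s_B_even .
qed

text \<open>
  A tie-breaker's tie-breaker is a one-point set tie-breaker: a lead of two already implies having
  at least one point.
\<close>

lemma STT_prob_eq:
  assumes "x \<in> {0..1}" "y \<in> {0..1}" "\<not> (x = 0 \<and> y = 0)" "\<not> (x = 1 \<and> y = 1)"
  shows "\<theta>_STT x y = STT_prob x y"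
proof -
  have "STT_rule = ST_rule 1" by (auto simp: STT_rule_def ST_rule_def fun_eq_iff)
  then have "\<theta>_STT x y = \<theta>_ST x y 1" by (simp add: \<theta>_STT_def \<theta>_ST_def)
  also have "binomial_sum_pmf 0 0 x (1 - y) = return_pmf 0"
    using assms by (simp add: binomial_sum_pmf_def binomial_pmf_0 pair_pmf_def bind_return_pmf)
  then have "\<theta>_ST x y 1 = STT_prob x y"
    using ST_prob_eq[of 1 x y] assms by (simp add: measure_return_pmf)
  finally show ?thesis .
qed

lemma ST_win_prob:
  assumes "h + 2 \<le> K" "x \<in> {0..1}" "y \<in> {0..1}"
  shows "\<theta>_ST_win K h x y K = pmf (binomial_sum_pmf (s_A (K + h - 1)) (s_B (K + h - 1)) x (1 - y)) (K - 1)
    * first_server_point_prob x y (K + h)"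
proof -
  have "Suc (K + h - 1) = K + h" using assms by simp
  then show ?thesis
    unfolding \<theta>_ST_win_def ST_win_iff[OF assms(1)]
    using prob_next_won[OF decided_after_score_A[where R="\<lambda>a. a = K - 1" and m="K + h - 1" and n="K + h - 1"] assms(2,3)]
    by (simp add: prob_score_A[OF assms(2,3)])
qed

lemma ST_reach_prob:
  assumes "1 \<le> K" "x \<in> {0..1}" "y \<in> {0..1}"
  shows "\<theta>_ST_reach (K - 1) (K - 1) x y K = pmf (binomial_sum_pmf (K - 1) (K - 1) x (1 - y)) (K - 1)"
  unfolding \<theta>_ST_reach_def ST_reach_iff[OF assms(1)] prob_score_A[OF assms(2,3)] s_A_even s_B_even ..

text \<open>
  The final scores \<open>(K, h)\<close> are mutually exclusive, since \<open>A\<close> gets the \<open>K\<close>th point only once.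
\<close>

lemma sum_ST_win_prob:
  assumes "1 \<le> K" "x \<in> {0..1}" "y \<in> {0..1}"
  shows "(\<Sum>h<K - 1. \<theta>_ST_win K h x y K) =
    measure_pmf.prob (binomial_sum_pmf (K - 1) (K - 1) x (1 - y)) {K..}"
proof -
  let ?M = "points x y"
  interpret P: prob_space ?M by (rule prob_space_points)
  define E where "E h = {\<omega> \<in> space ?M. score_A \<omega> (K + h - 1) = K - 1 \<and> \<omega> (K + h)}" for h
  have "E h \<in> sets ?M" for h
    unfolding E_def using assms(1)
    by (intro decided_after_sets[of "K + h"] decided_after_conj
        decided_after_score_A[where R="\<lambda>a. a = K - 1"] decided_after_point[where R="\<lambda>b. b"]) auto
  moreover have "disjoint_family_on E {..<K - 1}"
  proof -
    have "\<not> (score_A \<omega> (K + h - 1) = K - 1 \<and> \<omega> (K + h) \<and> score_A \<omega> (K + h' - 1) = K - 1)" if "h < h'" for h h' \<omega>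
    proof
      assume h: "score_A \<omega> (K + h - 1) = K - 1 \<and> \<omega> (K + h) \<and> score_A \<omega> (K + h' - 1) = K - 1"
      moreover have "Suc (K + h - 1) = K + h" "K + h \<le> K + h' - 1" using that assms(1) by linarith+
      ultimately have "score_A \<omega> (K + h) = K - 1 + 1"
        using score_A_Suc[of \<omega> "K + h - 1"] by (simp only: of_bool_eq)
      then show False using score_A_mono[of "K + h" "K + h' - 1" \<omega>] h \<open>K + h \<le> _\<close> by linarith
    qed
    then show ?thesis unfolding disjoint_family_on_def E_def by (auto, metis linorder_neqE_nat)
  qed
  ultimately have "P.prob (\<Union>h<K - 1. E h) = (\<Sum>h<K - 1. P.prob (E h))"
    by (intro P.finite_measure_finite_Union) auto
  moreover have "P.prob (E h) = \<theta>_ST_win K h x y K" if "h < K - 1" for h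
    using that unfolding \<theta>_ST_win_def E_def by (subst ST_win_iff) auto
  moreover have "(\<Union>h<K - 1. E h) = {\<omega> \<in> space ?M. K \<le> score_A \<omega> (2 * (K - 1))}"
    unfolding score_A_reaches_iff[OF assms(1), symmetric] by (auto simp: E_def)
  ultimately show ?thesis
    by (simp add: prob_score_A_ge[OF assms(2,3)] s_A_even s_B_even)
qed

theorem proposition3p4:
  fixes K :: nat and p\<^sub>A p\<^sub>B q\<^sub>A q\<^sub>B :: real
  assumes "K \<ge> 1"
    and "p\<^sub>A \<in> {0..1}" and "p\<^sub>B \<in> {0..1}"
    and "\<not> (p\<^sub>A = 0 \<and> p\<^sub>B = 0)" and "\<not> (p\<^sub>A = 1 \<and> p\<^sub>B = 1)"
    and "q\<^sub>A = 1 - p\<^sub>A" and "q\<^sub>B = 1 - p\<^sub>B"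
  shows "\<theta>_ST p\<^sub>A p\<^sub>B K =
      (\<Sum>h<K-1. \<theta>_ST_win K h p\<^sub>A p\<^sub>B K)
      + \<theta>_ST_reach (K-1) (K-1) p\<^sub>A p\<^sub>B K
        * (\<theta>_STT p\<^sub>A p\<^sub>B) ^ (I_A (2*K-1)) * (1 - \<theta>_STT p\<^sub>B p\<^sub>A) ^ (1 - I_A (2*K-1))
    \<and> (\<forall>h. h + 2 \<le> K \<longrightarrow>
        \<theta>_ST_win K h p\<^sub>A p\<^sub>B K =
        (\<Sum>j=0..K-1. real (s_A (K+h-1) choose j) * real (s_B (K+h-1) choose (K-1-j))
            * (p\<^sub>A ^ j * q\<^sub>A ^ (s_A (K+h-1) - j))
            * (q\<^sub>B ^ (K-1-j) * p\<^sub>B ^ (s_B (K+h-1) - (K-1-j))))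
        * (p\<^sub>A ^ (I_A (K+h)) * q\<^sub>B ^ (1 - I_A (K+h))))
    \<and> \<theta>_ST_reach (K-1) (K-1) p\<^sub>A p\<^sub>B K =
        (\<Sum>j=0..K-1. real ((K-1) choose j) * real ((K-1) choose j)
            * (p\<^sub>A ^ j * q\<^sub>A ^ (K-1-j)) * (q\<^sub>B ^ (K-1-j) * p\<^sub>B ^ j))
    \<and> (\<Sum>h<K-1. \<theta>_ST_win K h p\<^sub>A p\<^sub>B K) =
        measure_pmf.prob (pair_pmf (binomial_pmf (K-1) p\<^sub>A) (binomial_pmf (K-1) q\<^sub>B))
          {(u, v). u + v \<ge> K}
    \<and> \<theta>_ST p\<^sub>A p\<^sub>B K = \<theta>_ST q\<^sub>B q\<^sub>A K"
proof (intro conjI allI impI)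
  note K = assms(1) and p = assms(2,3) and nondeg = assms(4,5) and qA = assms(6) and qB = assms(7)
  have q01: "q\<^sub>A \<in> {0..1}" "q\<^sub>B \<in> {0..1}" using p by (auto simp: qA qB)
  let ?D = "binomial_sum_pmf (K - 1) (K - 1) p\<^sub>A q\<^sub>B"
  have D: "\<theta>_ST p\<^sub>A p\<^sub>B K = measure_pmf.prob ?D {K..} + pmf ?D (K - 1) * STT_prob p\<^sub>A p\<^sub>B"
    using ST_prob_eq[OF K p nondeg] by (simp add: qB)
  have other: "1 - \<theta>_STT p\<^sub>B p\<^sub>A = STT_prob p\<^sub>A p\<^sub>B"
    using STT_prob_eq[OF p(2,1)] STT_prob_swap[OF p nondeg] nondeg by auto
  show "\<theta>_ST p\<^sub>A p\<^sub>B K = (\<Sum>h<K-1. \<theta>_ST_win K h p\<^sub>A p\<^sub>B K)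
      + \<theta>_ST_reach (K-1) (K-1) p\<^sub>A p\<^sub>B K
        * (\<theta>_STT p\<^sub>A p\<^sub>B) ^ (I_A (2*K-1)) * (1 - \<theta>_STT p\<^sub>B p\<^sub>A) ^ (1 - I_A (2*K-1))"
    unfolding D other STT_prob_eq[OF p nondeg] sum_ST_win_prob[OF K p] ST_reach_prob[OF K p] qB
    using I_A_cases[of "2 * K - 1"] by auto
  show "\<theta>_ST_win K h p\<^sub>A p\<^sub>B K =
        (\<Sum>j=0..K-1. real (s_A (K+h-1) choose j) * real (s_B (K+h-1) choose (K-1-j))
            * (p\<^sub>A ^ j * q\<^sub>A ^ (s_A (K+h-1) - j))
            * (q\<^sub>B ^ (K-1-j) * p\<^sub>B ^ (s_B (K+h-1) - (K-1-j))))
        * (p\<^sub>A ^ (I_A (K+h)) * q\<^sub>B ^ (1 - I_A (K+h)))" if "h + 2 \<le> K" for h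
  proof -
    have "first_server_point_prob p\<^sub>A p\<^sub>B (K + h) = p\<^sub>A ^ I_A (K+h) * q\<^sub>B ^ (1 - I_A (K+h))"
      using I_A_cases[of "K + h"] by (auto simp: first_server_point_prob_def qB)
    then show ?thesis
      using p q01 unfolding ST_win_prob[OF that p] 
      by (simp add: pmf_binomial_sum qA qB atLeast0AtMost mult_ac)
  qed
  show "\<theta>_ST_reach (K-1) (K-1) p\<^sub>A p\<^sub>B K =
        (\<Sum>j=0..K-1. real ((K-1) choose j) * real ((K-1) choose j)
            * (p\<^sub>A ^ j * q\<^sub>A ^ (K-1-j)) * (q\<^sub>B ^ (K-1-j) * p\<^sub>B ^ j))"
    using pmf_binomial_sum_diagonal[OF p(1) q01(2), of "K - 1"]
    unfolding ST_reach_prob[OF K p] by (simp add: qA qB)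
  show "(\<Sum>h<K-1. \<theta>_ST_win K h p\<^sub>A p\<^sub>B K) =
        measure_pmf.prob (pair_pmf (binomial_pmf (K-1) p\<^sub>A) (binomial_pmf (K-1) q\<^sub>B)) {(u, v). u + v \<ge> K}"
    unfolding sum_ST_win_prob[OF K p] binomial_sum_pmf_def qB
    by (auto simp: vimage_def intro!: arg_cong[where f="measure _"])
  have "\<theta>_ST q\<^sub>B q\<^sub>A K = measure_pmf.prob ?D {K..} + pmf ?D (K - 1) * STT_prob q\<^sub>B q\<^sub>A"
    using ST_prob_eq[OF K q01(2,1)] nondeg binomial_sum_pmf_commute[of "K - 1" "K - 1" "1 - p\<^sub>B" "p\<^sub>A"]
    by (auto simp: qA qB)
  moreover have "STT_prob q\<^sub>B q\<^sub>A = STT_prob p\<^sub>A p\<^sub>B"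
  proof -
    have "q\<^sub>B * (1 - q\<^sub>A) = p\<^sub>A * (1 - p\<^sub>B)" "q\<^sub>A * (1 - q\<^sub>B) = p\<^sub>B * (1 - p\<^sub>A)"
      by (simp_all add: qA qB)
    then show ?thesis by (simp only: STT_prob_def)
  qed
  ultimately show "\<theta>_ST p\<^sub>A p\<^sub>B K = \<theta>_ST q\<^sub>B q\<^sub>A K"
    by (simp only: D)
qed

end
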